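(* Let $n\in\mathbb{N}$. Then for all $\alpha,\beta\in\mathbb{C}$ with $\operatorname{Re}(\alpha),\operatorname{Re}(\beta),\operatorname{Re}(\alpha+\beta)\in(0,n/2)$ and all $x,y\in\mathbb{R}^n$ with $x\neq y$, $$\int_{\mathbb{R}^n} d^n x' \, |x-x'|^{2\alpha-n}\,|x'-y|^{2\beta-n} = k_{\alpha,\beta,n}\,|x-y|^{2\alpha+2\beta-n},$$ where $$k_{\alpha,\beta,n}=\pi^{n/2}\,\frac{\Gamma(\alpha)\Gamma(\beta)\Gamma((n/2)-\alpha-\beta)}{\Gamma(\alpha+\beta)\Gamma((n/2)-\alpha)\Gamma((n/2)-\beta)}=\frac{\gamma_{\alpha,n}\gamma_{\beta,n}}{\gamma_{\alpha+\beta,n}},\qquad \gamma_{\alpha,n}=\pi^{n/2}\,2^{2\alpha}\,\frac{\Gamma(\alpha)}{\Gamma((n/2)-\alpha)}.$$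
   Context: $\Gamma$ denotes the Gamma function and $d^nx'$ is Lebesgue measure on $\mathbb{R}^n$. For $r>0$ and $s\in\mathbb{C}$, $r^s=e^{s\ln r}$ with real logarithm. *)

theory Defs
  imports "HOL-Analysis.Analysis"
begin

definition riesz_gamma :: "complex \<Rightarrow> nat \<Rightarrow> complex" where
  "riesz_gamma \<alpha> n =
     of_real pi powr (of_nat n / 2) * 2 powr (2 * \<alpha>) *
     (Gamma \<alpha> / Gamma (of_nat n / 2 - \<alpha>))"

definition riesz_k :: "complex \<Rightarrow> complex \<Rightarrow> nat \<Rightarrow> complex" where
  "riesz_k \<alpha> \<beta> n =
     of_real pi powr (of_nat n / 2) *
     ((Gamma \<alpha> * Gamma \<beta> * Gamma (of_nat n / 2 - \<alpha> - \<beta>)) /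
      (Gamma (\<alpha> + \<beta>) * Gamma (of_nat n / 2 - \<alpha>) * Gamma (of_nat n / 2 - \<beta>)))"

text \<open>
  For \<open>r > 0\<close> the complex power \<open>of_real r powr s\<close> is \<open>exp (s * of_real (ln r))\<close>. At \<open>r = 0\<close>
  it is \<open>0\<close>, so the kernel below gets the value \<open>0\<close> on the null set \<open>{x, y}\<close>, where the
  informal integrand may be undefined.
\<close>

definition riesz_integrand ::
  "complex \<Rightarrow> complex \<Rightarrow> real ^ 'n \<Rightarrow> real ^ 'n \<Rightarrow> real ^ 'n \<Rightarrow> complex" where
  "riesz_integrand \<alpha> \<beta> x y x' =
     of_real (norm (x - x')) powr (2 * \<alpha> - of_nat CARD('n)) *
     of_real (norm (x' - y)) powr (2 * \<beta> - of_nat CARD('n))"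

end

theory Submission
  imports Defs "HOL-Probability.Distributions"
begin

text \<open>
  Put \<open>a = n/2 - \<alpha>\<close> and \<open>b = n/2 - \<beta>\<close>. The Beta integral over \<open>(0, \<infinity>)\<close> merges the two factors
  into one quadratic (Feynman's parametrisation),
  \<open>\<Gamma>(a) \<Gamma>(b) / \<Gamma>(a + b) A\<^sup>-\<^sup>a B\<^sup>-\<^sup>b = \<integral> w\<^bsup>a-1\<^esup> (w A + B)\<^bsup>-a-b\<^esup> dw\<close>, with \<open>A = |x - z|\<^sup>2\<close> and
  \<open>B = |z - y|\<^sup>2\<close>. Completing the square turns \<open>w A + B\<close> into
  \<open>(1 + w) |z - c|\<^sup>2 + w |x - y|\<^sup>2 / (1 + w)\<close>, whose powers are integrated over \<open>z\<close> by writing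
  them as a Gamma integral of Gaussians; what is left is a Beta integral in \<open>w\<close> with parameters
  \<open>\<beta>\<close> and \<open>\<alpha>\<close>. Each exchange of integrals is justified by noting that the modulus of the integrand
  is the same integrand with the real parts of the parameters.
\<close>

section \<open>Complex powers of real bases, and zeros of \<open>Gamma\<close>\<close>

lemma of_real_powr_eq_exp:
  fixes z :: complex
  shows "t > 0 \<Longrightarrow> of_real t powr z = exp (z * of_real (ln t))"
  by (simp add: powr_def Ln_of_real)

lemma of_real_norm_powr:
  fixes z :: complex
  shows "t > 0 \<Longrightarrow> complex_of_real (norm (of_real t powr z)) = of_real t powr of_real (Re z)"
  by (simp add: norm_powr_real_powr powr_of_real)

text \<open>The principal logarithm of a nonzero real \<open>t\<close> is the real logarithm of its
  absolute value, plus \<open>pi * \<i>\<close> when \<open>t < 0\<close>; written out this way, the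
  power is a case distinction between measurable functions.\<close>

lemma borel_measurable_of_real_powr [measurable]:
  fixes z :: complex
  assumes [measurable]: "f \<in> borel_measurable M"
  shows "(\<lambda>x. of_real (f x) powr z) \<in> borel_measurable M"
proof -
  have "(\<lambda>x. of_real (f x) powr z) = (\<lambda>x. if f x = 0 then 0
      else exp (z * (of_real (ln \<bar>f x\<bar>) + (if f x < 0 then of_real pi else 0) * \<i>)))"
    by (auto simp: fun_eq_iff powr_def Ln_of_real')
  also have "\<dots> \<in> borel_measurable M"
    by measurable
  finally show ?thesis .
qed

text \<open>\<open>Gamma\<close> takes the value 0 only at its poles, by convention, and these are
  the nonpositive integers. The lemma serves to cancel Gamma factors.\<close>

lemma Gamma_nonzero_if_Re_pos:
  fixes z :: complex
  shows "Re z > 0 \<Longrightarrow> Gamma z \<noteq> 0"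
  by (auto simp: Gamma_eq_zero_iff elim!: nonpos_Ints_cases)

section \<open>Exchange of iterated integrals\<close>

text \<open>Integrability of \<open>N\<close> gives integrability of \<open>f\<close> on the
  product, and then both iterated integrals agree. \<open>N\<close> is complex-valued so that it can
  be instantiated with \<open>F\<close> at the real parts of the parameters. \<open>G\<close> is
  prescribed only almost everywhere because the Riesz kernel is singular at two points.\<close>

lemma has_bochner_integral_Fubini_swap:
  fixes f :: "'a::euclidean_space \<Rightarrow> 'b::euclidean_space \<Rightarrow> complex"
  assumes f: "case_prod f \<in> borel_measurable (lborel \<Otimes>\<^sub>M lborel)"
    and F: "\<And>x. has_bochner_integral lborel (f x) (F x)"
    and N: "\<And>x. has_bochner_integral lborel (\<lambda>y. complex_of_real (norm (f x y))) (N x)"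
    and N_integrable: "integrable lborel N"
    and I: "has_bochner_integral lborel F I"
    and G: "AE y in lborel. has_bochner_integral lborel (\<lambda>x. f x y) (G y)"
    and [measurable]: "G \<in> borel_measurable lborel"
  shows "has_bochner_integral lborel G I"
proof -
  have "of_real (LINT y|lborel. norm (f x y)) = N x" for x
    using N[of x] by (simp add: has_bochner_integral_iff)
  hence "integrable lborel (\<lambda>x. complex_of_real (LINT y|lborel. norm (f x y)))"
    using N_integrable by simp
  hence "integrable lborel (\<lambda>x. LINT y|lborel. norm (f x y))"
    using integrable_Re by fastforce
  hence "integrable (lborel \<Otimes>\<^sub>M lborel) (case_prod f)"
    using F by (intro lborel_pair.Fubini_integrable f)
      (auto simp: has_bochner_integral_iff)
  note prod = this
  have "LINT y|lborel. f x y = F x" for x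
    using F[of x] by (simp add: has_bochner_integral_iff)
  hence "(LINT y|lborel. LINT x|lborel. f x y) = I"
    using lborel_pair.Fubini_integral[OF prod] I by (simp add: has_bochner_integral_iff)
  hence "has_bochner_integral lborel (\<lambda>y. LINT x|lborel. f x y) I"
    using lborel_pair.integrable_snd[OF prod] by (simp add: has_bochner_integral_iff)
  moreover have "AE y in lborel. (LINT x|lborel. f x y) = G y"
    using G by eventually_elim (simp add: has_bochner_integral_iff)
  ultimately show ?thesis
    using f by (subst has_bochner_integral_cong_AE[where g = "\<lambda>y. LINT x|lborel. f x y"])
      (auto simp: has_bochner_integral_iff)
qed

section \<open>Gamma, Gaussian and Beta integrals\<close>

text \<open>This is Euler's integral after the substitution of \<open>A * t\<close> for
  \<open>t\<close>.\<close>

lemma has_bochner_integral_Gamma: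
  assumes z: "Re z > 0" and A: "A > 0"
  shows "has_bochner_integral lborel
    (\<lambda>t. if t > 0 then of_real t powr (z - 1) * of_real (exp (- (A * t))) else 0)
    (Gamma z * of_real A powr (- z))"
proof -
  define f where "f = (\<lambda>t. if t > 0 then of_real t powr (z - 1) * complex_of_real (exp (- t)) else 0)"
  have f_eq: "f = (\<lambda>t. indicator {0<..} t *\<^sub>R (of_real t powr (z - 1) / complex_of_real (exp t)))"
    by (auto simp: f_def fun_eq_iff exp_minus field_simps)
  have [measurable]: "f \<in> borel_measurable borel"
    unfolding f_def by measurable
  have abs: "(\<lambda>t. complex_of_real t powr (z - 1) / of_real (exp t)) absolutely_integrable_on {0<..}"
    by (rule absolutely_integrable_Gamma_integral'[OF z])
  hence int: "integrable lebesgue f"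
    by (simp add: set_integrable_def f_eq)
  have "integral\<^sup>L lebesgue f = Gamma z"
    using set_lebesgue_integral_eq_integral(2)[OF abs] Gamma_integral_complex'[OF z]
    by (simp add: f_eq set_lebesgue_integral_def integral_unique)
  \<comment> \<open>Lebesgue measure is the completion of \<open>lborel\<close>, and
    \<open>f\<close> is Borel measurable, so the integral carries over.\<close>
  with int have "has_bochner_integral lborel f (Gamma z)"
    by (simp add: has_bochner_integral_iff integrable_completion integral_completion)
  hence "has_bochner_integral lborel (\<lambda>t. f (0 + A * t)) (Gamma z /\<^sub>R \<bar>A\<bar>)"
    using A by (subst (asm) lborel_has_bochner_integral_real_affine_iff[of A _ _ 0]) auto
  \<comment> \<open>The factor \<open>A powr (1 - z)\<close> removes \<open>A\<close> from
    \<open>(A * t) powr (z - 1)\<close>; with the Jacobian \<open>1 / A\<close> it leaves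
    \<open>A powr (- z)\<close> in the value.\<close>
  hence "has_bochner_integral lborel (\<lambda>t. of_real A powr (1 - z) * f (A * t))
      (of_real A powr (1 - z) * (Gamma z /\<^sub>R A))"
    using A by (intro has_bochner_integral_mult_right) auto
  moreover have "of_real A powr (1 - z) * (Gamma z /\<^sub>R A) = Gamma z * of_real A powr (- z)"
    using A by (simp add: powr_diff powr_minus scaleR_conv_of_real field_simps)
  moreover have "of_real A powr (1 - z) * f (A * t)
      = (if t > 0 then of_real t powr (z - 1) * of_real (exp (- (A * t))) else 0)" for t
    using A by (auto simp: f_def zero_less_mult_iff of_real_powr_eq_exp ln_mult exp_add exp_diff exp_minus field_simps
        simp del: of_real_mult)
  ultimately show ?thesis by simp
qed

text \<open>The Gaussian factors over the coordinates, and each coordinate contributes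
  \<open>sqrt (pi / p)\<close>.\<close>

lemma has_bochner_integral_gaussian:
  fixes c :: "'a::euclidean_space"
  assumes p: "p > 0"
  shows "has_bochner_integral lborel (\<lambda>x. exp (- (p * (norm (x - c))\<^sup>2)))
           ((pi / p) powr (DIM('a) / 2))"
proof -
  have one_dim: "(\<integral>\<^sup>+x. ennreal (exp (- (p * (x - m)\<^sup>2))) \<partial>lborel) = ennreal (sqrt (pi / p))" for m
  proof -
    \<comment> \<open>This standard deviation makes \<open>1 / (2 * \<sigma>\<^sup>2) = p\<close>,
      so the integrand is a multiple of a normal density, whose total mass is 1.\<close>
    define \<sigma> where "\<sigma> = 1 / sqrt (2 * p)"
    have \<sigma>: "\<sigma> > 0" "\<sigma>\<^sup>2 = 1 / (2 * p)"
      using p by (auto simp: \<sigma>_def power_divide)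
    have "exp (- (p * (x - m)\<^sup>2)) = sqrt (pi / p) * normal_density m \<sigma> x" for x
      using p by (simp add: normal_density_def \<sigma> real_sqrt_divide field_simps)
    moreover have "(\<integral>\<^sup>+x. ennreal (sqrt (pi / p) * normal_density m \<sigma> x) \<partial>lborel)
        = ennreal (sqrt (pi / p))"
      using \<sigma> p by (subst nn_integral_eq_integral) auto
    ultimately show ?thesis by simp
  qed
  have "exp (- (p * (norm (x - c))\<^sup>2)) = (\<Prod>b\<in>Basis. exp (- (p * (x \<bullet> b - c \<bullet> b)\<^sup>2)))" for x
  proof -
    have "(norm (x - c))\<^sup>2 = (\<Sum>b\<in>Basis. (x \<bullet> b - c \<bullet> b)\<^sup>2)"
      by (subst power2_norm_eq_inner, subst euclidean_inner) (simp add: inner_diff_left power2_eq_square)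
    thus ?thesis
      by (simp add: exp_sum sum_distrib_left flip: sum_negf)
  qed
  hence "(\<integral>\<^sup>+x. ennreal (exp (- (p * (norm (x - c))\<^sup>2))) \<partial>lborel)
      = (\<integral>\<^sup>+x. (\<Prod>b\<in>Basis. ennreal (exp (- (p * (x \<bullet> b - c \<bullet> b)\<^sup>2)))) \<partial>lborel)"
    by (simp add: prod_ennreal)
  also have "\<dots> = (\<Prod>b\<in>(Basis :: 'a set). ennreal (sqrt (pi / p)))"
    by (subst nn_integral_lborel_prod) (auto simp: one_dim)
  also have "\<dots> = ennreal ((pi / p) powr (DIM('a) / 2))"
    using p by (simp add: ennreal_power powr_half_sqrt[symmetric] powr_power)
  finally show ?thesis
    by (intro has_bochner_integral_nn_integral) auto
qed

text \<open>Expand \<open>Gamma (a + b) * (w * A + B) powr (- (a + b))\<close> as a Gamma integral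
  in \<open>t\<close>. Integrating over \<open>w\<close> first leaves a Gamma integral in
  \<open>t\<close> with parameter \<open>b\<close>.\<close>

lemma has_bochner_integral_Beta:
  assumes a: "Re a > 0" and b: "Re b > 0" and A: "A > 0" and B: "B > 0"
  shows "has_bochner_integral lborel
    (\<lambda>w. if w > 0 then of_real w powr (a - 1) * of_real (w * A + B) powr (- (a + b)) else 0)
    (Gamma a * Gamma b / Gamma (a + b) * of_real A powr (- a) * of_real B powr (- b))"
proof -
  \<comment> \<open>The parameters are arguments of \<open>f\<close> and \<open>F\<close>, so that
    the evaluation of the inner integral also applies to the modulus, through the real
    parts.\<close>
  define f :: "complex \<Rightarrow> complex \<Rightarrow> real \<Rightarrow> real \<Rightarrow> complex" where
    "f = (\<lambda>a b t w. if t > 0 \<and> w > 0 then of_real t powr (a + b - 1) * of_real w powr (a - 1)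
            * of_real (exp (- (t * (w * A + B)))) else 0)"
  define F :: "complex \<Rightarrow> complex \<Rightarrow> real \<Rightarrow> complex" where
    "F = (\<lambda>a b t. Gamma a * of_real A powr (- a) *
            (if t > 0 then of_real t powr (b - 1) * of_real (exp (- (B * t))) else 0))"
  have meas: "case_prod (f a b) \<in> borel_measurable (lborel \<Otimes>\<^sub>M lborel)"
    unfolding f_def by measurable
  have F: "has_bochner_integral lborel (f a b t) (F a b t)" if "Re a > 0" for a b t
  proof (cases "t > 0")
    case True
    have "has_bochner_integral lborel
       (\<lambda>w. (of_real t powr (a + b - 1) * of_real (exp (- (B * t)))) *
          (if w > 0 then of_real w powr (a - 1) * complex_of_real (exp (- ((A * t) * w))) else 0))
       ((of_real t powr (a + b - 1) * of_real (exp (- (B * t)))) * (Gamma a * of_real (A * t) powr (- a)))"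
      using A True by (intro has_bochner_integral_mult_right has_bochner_integral_Gamma that) auto
    also have "(of_real t powr (a + b - 1) * of_real (exp (- (B * t)))) * (Gamma a * of_real (A * t) powr (- a))
        = F a b t"
      using A True by (simp add: F_def of_real_powr_eq_exp ln_mult exp_add exp_diff exp_minus field_simps del: of_real_mult)
    also have "(\<lambda>w. (of_real t powr (a + b - 1) * of_real (exp (- (B * t)))) *
          (if w > 0 then of_real w powr (a - 1) * complex_of_real (exp (- ((A * t) * w))) else 0)) = f a b t"
      using True by (auto simp: f_def fun_eq_iff algebra_simps simp flip: exp_add of_real_mult)
    finally show ?thesis .
  qed (simp add: f_def F_def has_bochner_integral_zero)
  have I: "has_bochner_integral lborel (F a b) (Gamma a * of_real A powr (- a) * (Gamma b * of_real B powr (- b)))"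
    if "Re b > 0" for a b
    unfolding F_def using that B by (intro has_bochner_integral_mult_right has_bochner_integral_Gamma) auto
  have norm_f: "of_real (norm (f a b t w)) = f (of_real (Re a)) (of_real (Re b)) t w" for t w
    by (auto simp: f_def norm_mult of_real_norm_powr)
  have "has_bochner_integral lborel
    (\<lambda>w. Gamma (a + b) * (if w > 0 then of_real w powr (a - 1) * of_real (w * A + B) powr (- (a + b)) else 0))
    (Gamma a * of_real A powr (- a) * (Gamma b * of_real B powr (- b)))"
  proof (rule has_bochner_integral_Fubini_swap[OF meas F _ _ I])
    show "has_bochner_integral lborel (\<lambda>w. of_real (norm (f a b t w))) (F (of_real (Re a)) (of_real (Re b)) t)" for t
      unfolding norm_f using a by (intro F) auto
    show "integrable lborel (F (of_real (Re a)) (of_real (Re b)))"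
      using I[of "of_real (Re b)" "of_real (Re a)"] b by (auto simp: has_bochner_integral_iff)
    have "has_bochner_integral lborel (\<lambda>t. f a b t w) (Gamma (a + b) *
        (if w > 0 then of_real w powr (a - 1) * of_real (w * A + B) powr (- (a + b)) else 0))" for w
    proof (cases "w > 0")
      case True
      have "has_bochner_integral lborel
         (\<lambda>t. of_real w powr (a - 1) * (if t > 0 then of_real t powr (a + b - 1) *
              complex_of_real (exp (- ((w * A + B) * t))) else 0))
         (of_real w powr (a - 1) * (Gamma (a + b) * of_real (w * A + B) powr (- (a + b))))"
        using A B a b True
        by (intro has_bochner_integral_mult_right has_bochner_integral_Gamma add_pos_pos mult_pos_pos) auto
      also have "(\<lambda>t. of_real w powr (a - 1) * (if t > 0 then of_real t powr (a + b - 1) *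
              complex_of_real (exp (- ((w * A + B) * t))) else 0)) = (\<lambda>t. f a b t w)"
        using True by (auto simp: f_def fun_eq_iff mult.commute)
      finally show ?thesis using True by (simp add: mult_ac)
    qed (simp add: f_def has_bochner_integral_zero)
    thus "AE w in lborel. has_bochner_integral lborel (\<lambda>t. f a b t w) (Gamma (a + b) *
        (if w > 0 then of_real w powr (a - 1) * of_real (w * A + B) powr (- (a + b)) else 0))"
      by simp
  qed (use a b in measurable)
  hence "has_bochner_integral lborel
    (\<lambda>w. (1 / Gamma (a + b)) * (Gamma (a + b) *
      (if w > 0 then of_real w powr (a - 1) * of_real (w * A + B) powr (- (a + b)) else 0)))
    ((1 / Gamma (a + b)) * (Gamma a * of_real A powr (- a) * (Gamma b * of_real B powr (- b))))"
    by (rule has_bochner_integral_mult_right)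
  moreover have "Gamma (a + b) \<noteq> 0"
    using a b by (intro Gamma_nonzero_if_Re_pos) auto
  ultimately show ?thesis
    by (simp add: field_simps)
qed

section \<open>The space integral for a fixed Feynman parameter\<close>

text \<open>As a Gamma integral in \<open>t\<close>, the power is a superposition of Gaussians in
  \<open>x\<close>. The condition on \<open>Re m\<close> makes the remaining
  \<open>t\<close>-integral converge at 0.\<close>

lemma has_bochner_integral_powr_quadratic:
  fixes c :: "'a::euclidean_space" and m :: complex
  assumes m: "Re m > DIM('a) / 2" and p: "p > 0" and q: "q > 0"
  shows "has_bochner_integral lborel
    (\<lambda>x. of_real (p * (norm (x - c))\<^sup>2 + q) powr (- m))
    (of_real pi powr (of_nat DIM('a) / 2) * Gamma (m - of_nat DIM('a) / 2) / Gamma m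
       * of_real p powr (- of_nat DIM('a) / 2) * of_real q powr (of_nat DIM('a) / 2 - m))"
proof -
  define h where "h = real DIM('a) / 2"
  have h: "of_nat DIM('a) / 2 = complex_of_real h" "h > 0"
    by (simp_all add: h_def)
  define f :: "complex \<Rightarrow> real \<Rightarrow> 'a \<Rightarrow> complex" where
    "f = (\<lambda>m t x. if t > 0 then of_real t powr (m - 1)
            * of_real (exp (- (t * (p * (norm (x - c))\<^sup>2 + q)))) else 0)"
  \<comment> \<open>The Gaussian integral contributes \<open>(pi / (t * p)) powr h\<close>, which
    lowers the exponent of \<open>t\<close> from \<open>m - 1\<close> to
    \<open>m - h - 1\<close>.\<close>
  define F :: "complex \<Rightarrow> real \<Rightarrow> complex" where
    "F = (\<lambda>m t. of_real pi powr of_real h * of_real p powr (- of_real h) *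
            (if t > 0 then of_real t powr (m - of_real h - 1) * of_real (exp (- (q * t))) else 0))"
  have meas: "case_prod (f m) \<in> borel_measurable (lborel \<Otimes>\<^sub>M lborel)"
    unfolding f_def by measurable
  have F: "has_bochner_integral lborel (f m t) (F m t)" for m t
  proof (cases "t > 0")
    case True
    have "has_bochner_integral lborel (\<lambda>x. exp (- (t * p * (norm (x - c))\<^sup>2))) ((pi / (t * p)) powr h)"
      unfolding h_def using True p by (intro has_bochner_integral_gaussian) auto
    hence "has_bochner_integral lborel (\<lambda>x. of_real t powr (m - 1) * of_real (exp (- (q * t)))
              * complex_of_real (exp (- (t * p * (norm (x - c))\<^sup>2))))
            (of_real t powr (m - 1) * of_real (exp (- (q * t))) * complex_of_real ((pi / (t * p)) powr h))"
      by (intro has_bochner_integral_mult_right has_bochner_integral_of_real)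
    also have "of_real t powr (m - 1) * of_real (exp (- (q * t))) * complex_of_real ((pi / (t * p)) powr h)
        = F m t"
      using True p
      by (simp add: F_def of_real_powr_eq_exp powr_def Ln_of_real ln_mult ln_div exp_add exp_diff exp_minus field_simps
            flip: exp_of_real)
    also have "(\<lambda>x. of_real t powr (m - 1) * of_real (exp (- (q * t)))
              * complex_of_real (exp (- (t * p * (norm (x - c))\<^sup>2)))) = f m t"
      using True by (auto simp: f_def fun_eq_iff algebra_simps simp flip: exp_add of_real_mult)
    finally show ?thesis .
  qed (simp add: f_def F_def has_bochner_integral_zero)
  have I: "has_bochner_integral lborel (F m) (of_real pi powr of_real h * of_real p powr (- of_real h) *
       (Gamma (m - of_real h) * of_real q powr (- (m - of_real h))))"
    if "Re m > h" for m
    unfolding F_def using that q by (intro has_bochner_integral_mult_right has_bochner_integral_Gamma) auto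
  have norm_f: "of_real (norm (f m t x)) = f (of_real (Re m)) t x" for t x
    by (auto simp: f_def norm_mult of_real_norm_powr)
  have m': "Re m > h" using m by (simp add: h_def)
  have "has_bochner_integral lborel
    (\<lambda>x. Gamma m * of_real (p * (norm (x - c))\<^sup>2 + q) powr (- m))
    (of_real pi powr of_real h * of_real p powr (- of_real h) *
       (Gamma (m - of_real h) * of_real q powr (- (m - of_real h))))"
  proof (rule has_bochner_integral_Fubini_swap[OF meas F _ _ I])
    show "has_bochner_integral lborel (\<lambda>x. of_real (norm (f m t x))) (F (of_real (Re m)) t)" for t
      unfolding norm_f by (rule F)
    show "integrable lborel (F (of_real (Re m)))"
      using I[of "of_real (Re m)"] m' by (auto simp: has_bochner_integral_iff)
    have "has_bochner_integral lborel (\<lambda>t. f m t x)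
        (Gamma m * of_real (p * (norm (x - c))\<^sup>2 + q) powr (- m))" for x
    proof -
      have "has_bochner_integral lborel
         (\<lambda>t. if t > 0 then of_real t powr (m - 1) *
              complex_of_real (exp (- ((p * (norm (x - c))\<^sup>2 + q) * t))) else 0)
         (Gamma m * of_real (p * (norm (x - c))\<^sup>2 + q) powr (- m))"
        using p q m' h by (intro has_bochner_integral_Gamma add_nonneg_pos) auto
      thus ?thesis unfolding f_def by (simp only: mult.commute[of "p * (norm (x - c))\<^sup>2 + q"])
    qed
    thus "AE x in lborel. has_bochner_integral lborel (\<lambda>t. f m t x)
        (Gamma m * of_real (p * (norm (x - c))\<^sup>2 + q) powr (- m))"
      by simp
  qed (use m' in measurable)
  hence "has_bochner_integral lborel
    (\<lambda>x. (1 / Gamma m) * (Gamma m * of_real (p * (norm (x - c))\<^sup>2 + q) powr (- m)))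
    ((1 / Gamma m) * (of_real pi powr of_real h * of_real p powr (- of_real h) *
       (Gamma (m - of_real h) * of_real q powr (- (m - of_real h)))))"
    by (rule has_bochner_integral_mult_right)
  moreover have "Gamma m \<noteq> 0"
    using m' h by (intro Gamma_nonzero_if_Re_pos) auto
  ultimately show ?thesis
    by (simp add: h field_simps)
qed

text \<open>This is the parallel axis identity for masses \<open>w\<close> at \<open>x\<close> and 1
  at \<open>y\<close>: the subtracted point is their centre of mass and \<open>w / (1 + w)\<close>
  their reduced mass.\<close>

lemma weighted_sum_norm_squares:
  fixes x y z :: "'a::real_inner"
  assumes w: "w > 0"
  shows "w * (norm (x - z))\<^sup>2 + (norm (z - y))\<^sup>2
    = (1 + w) * (norm (z - (w *\<^sub>R x + y) /\<^sub>R (1 + w)))\<^sup>2 + w * (norm (x - y))\<^sup>2 / (1 + w)"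
proof -
  define u where "u = z - x"
  define v where "v = z - y"
  have "z - (w *\<^sub>R x + y) /\<^sub>R (1 + w) = ((1 + w) *\<^sub>R z - (w *\<^sub>R x + y)) /\<^sub>R (1 + w)"
    using w by (simp add: scaleR_diff_right)
  also have "(1 + w) *\<^sub>R z - (w *\<^sub>R x + y) = w *\<^sub>R u + v"
    by (simp add: u_def v_def algebra_simps)
  finally have c: "z - (w *\<^sub>R x + y) /\<^sub>R (1 + w) = (w *\<^sub>R u + v) /\<^sub>R (1 + w)" .
  have "(norm ((w *\<^sub>R u + v) /\<^sub>R (1 + w)))\<^sup>2 = (norm (w *\<^sub>R u + v))\<^sup>2 / (1 + w)\<^sup>2"
    using w by (simp add: power_divide divide_inverse_commute power_mult_distrib power_inverse)
  moreover have "x - y = v - u" "norm (x - z) = norm u" "z - y = v"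
    by (simp_all add: u_def v_def norm_minus_commute)
  \<comment> \<open>The mixed terms \<open>2 * w * (u \<bullet> v)\<close> of the two squares on the
    right cancel.\<close>
  moreover have "w * (u \<bullet> u) + v \<bullet> v = (1 + w) * (((w *\<^sub>R u + v) \<bullet> (w *\<^sub>R u + v)) / (1 + w)\<^sup>2)
      + w * ((v - u) \<bullet> (v - u)) / (1 + w)"
    using w by (simp add: inner_simps inner_commute power2_eq_square divide_simps) (simp add: algebra_simps)
  ultimately show ?thesis
    by (simp add: c power2_norm_eq_inner)
qed

section \<open>The composition formula\<close>

text \<open>The bounds on \<open>a\<close> and \<open>b\<close> give integrability at
  \<open>x\<close> and \<open>y\<close>, the bound on \<open>a + b\<close> gives it at infinity. The
  integrand times \<open>B\<close> is a Beta integral in \<open>w\<close>; integrating over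
  \<open>z\<close> first leaves another Beta integral.\<close>

lemma has_bochner_integral_riesz:
  fixes x y :: "'a::euclidean_space" and a b :: complex
  defines "h \<equiv> of_nat DIM('a) / 2"
  assumes a: "Re a < Re h" and b: "Re b < Re h" and ab: "Re (a + b) > Re h" and xy: "x \<noteq> y"
  shows "has_bochner_integral lborel
    (\<lambda>z. of_real (norm (x - z)) powr (- 2 * a) * of_real (norm (z - y)) powr (- 2 * b))
    (of_real pi powr h * (Gamma (h - a) * Gamma (h - b) * Gamma (a + b - h))
       / (Gamma (h - a + (h - b)) * Gamma a * Gamma b)
       * of_real (norm (x - y)) powr (2 * (h - a - b)))"
proof -
  define R where "R = norm (x - y)"
  have R: "R > 0" using xy by (simp add: R_def)
  define f :: "complex \<Rightarrow> complex \<Rightarrow> real \<Rightarrow> 'a \<Rightarrow> complex" where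
    "f = (\<lambda>a b w z. if w > 0 then of_real w powr (a - 1)
            * of_real (w * (norm (x - z))\<^sup>2 + (norm (z - y))\<^sup>2) powr (- (a + b)) else 0)"
  define K where "K = (\<lambda>a b. of_real pi powr h * Gamma (a + b - h) / Gamma (a + b) * of_real R powr (2 * (h - a - b)))"
  \<comment> \<open>The form \<open>w * 1 + 1\<close> and the order of the exponents match the Beta
    integral with \<open>A = B = 1\<close> and parameters \<open>h - b\<close>,
    \<open>h - a\<close>.\<close>
  define F :: "complex \<Rightarrow> complex \<Rightarrow> real \<Rightarrow> complex" where
    "F = (\<lambda>a b w. K a b *
            (if w > 0 then of_real w powr ((h - b) - 1) * of_real (w * 1 + 1) powr (- ((h - b) + (h - a))) else 0))"
  define B where "B = Gamma a * Gamma b / Gamma (a + b)"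
  define G where "G = (\<lambda>z. B * (of_real (norm (x - z)) powr (- 2 * a) * of_real (norm (z - y)) powr (- 2 * b)))"
  have Re_pos: "Re a > 0" "Re b > 0"
    using a b ab by auto
  have meas: "case_prod (f a b) \<in> borel_measurable (lborel \<Otimes>\<^sub>M lborel)"
    unfolding f_def by measurable
  have F: "has_bochner_integral lborel (f a b w) (F a b w)" if "Re (a + b) > Re h" for a b w
  proof (cases "w > 0")
    case True
    define c where "c = (w *\<^sub>R x + y) /\<^sub>R (1 + w)"
    have "has_bochner_integral lborel
       (\<lambda>z. of_real w powr (a - 1) * of_real ((1 + w) * (norm (z - c))\<^sup>2 + w * R\<^sup>2 / (1 + w)) powr (- (a + b)))
       (of_real w powr (a - 1) * (of_real pi powr h * Gamma (a + b - h) / Gamma (a + b)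
         * of_real (1 + w) powr (- h) * of_real (w * R\<^sup>2 / (1 + w)) powr (h - (a + b))))"
      using has_bochner_integral_powr_quadratic[of "a + b" "1 + w" "w * R\<^sup>2 / (1 + w)" c] True that R
      by (intro has_bochner_integral_mult_right) (simp add: h_def)
    also have "of_real w powr (a - 1) * (of_real pi powr h * Gamma (a + b - h) / Gamma (a + b)
         * of_real (1 + w) powr (- h) * of_real (w * R\<^sup>2 / (1 + w)) powr (h - (a + b))) = F a b w"
    proof -
      \<comment> \<open>The exponents add up to \<open>(a - 1) + (h - a - b) = h - b - 1\<close> for
        \<open>w\<close> and to \<open>- h - (h - a - b)\<close> for \<open>1 + w\<close>.\<close>
      have "of_real w powr (a - 1) * of_real (1 + w) powr (- h) * of_real (w * R\<^sup>2 / (1 + w)) powr (h - (a + b))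
        = of_real R powr (2 * (h - a - b)) * (of_real w powr ((h - b) - 1) * of_real (w * 1 + 1) powr (- ((h - b) + (h - a))))"
        using True R
        by (simp add: of_real_powr_eq_exp ln_mult ln_div ln_realpow del: of_real_mult of_real_add of_real_divide of_real_power flip: exp_add)
           (simp add: algebra_simps)
      thus ?thesis using True by (simp add: F_def K_def mult_ac)
    qed
    also have "(\<lambda>z. of_real w powr (a - 1) *
        of_real ((1 + w) * (norm (z - c))\<^sup>2 + w * R\<^sup>2 / (1 + w)) powr (- (a + b))) = f a b w"
      unfolding c_def R_def weighted_sum_norm_squares[OF True, symmetric] using True by (simp add: f_def)
    finally show ?thesis .
  qed (simp add: f_def F_def has_bochner_integral_zero)
  have I: "has_bochner_integral lborel (F a b) (K a b * (Gamma (h - b) * Gamma (h - a) / Gamma (h - b + (h - a))))"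
    if "Re a < Re h" "Re b < Re h" for a b
    unfolding F_def
    using has_bochner_integral_Beta[of "h - b" "h - a" 1 1] that by (intro has_bochner_integral_mult_right) simp
  \<comment> \<open>Since \<open>x \<noteq> y\<close>, the two squares cannot vanish together. Thus
    the formula for the modulus holds at every \<open>z\<close>, including \<open>x\<close> and
    \<open>y\<close>.\<close>
  have pos: "w * (norm (x - z))\<^sup>2 + (norm (z - y))\<^sup>2 > 0" if "w > 0" for w z
  proof (cases "z = x")
    case False
    thus ?thesis using that by (intro add_pos_nonneg mult_pos_pos) auto
  qed (use xy in simp)
  have norm_f: "of_real (norm (f a b w z)) = f (of_real (Re a)) (of_real (Re b)) w z" for w z
    using of_real_norm_powr[OF pos] by (auto simp: f_def norm_mult of_real_norm_powr)
  have "has_bochner_integral lborel G (K a b * (Gamma (h - b) * Gamma (h - a) / Gamma (h - b + (h - a))))"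
  proof (rule has_bochner_integral_Fubini_swap[OF meas F _ _ I])
    show "has_bochner_integral lborel (\<lambda>z. of_real (norm (f a b w z))) (F (of_real (Re a)) (of_real (Re b)) w)" for w
      unfolding norm_f using ab by (intro F) simp
    show "integrable lborel (F (of_real (Re a)) (of_real (Re b)))"
      using I[of "of_real (Re a)" "of_real (Re b)"] a b by (auto simp: has_bochner_integral_iff)
    \<comment> \<open>At these two points one of the squared distances is 0, while the Beta integral
      is stated for positive \<open>A\<close> and \<open>B\<close>.\<close>
    have "AE z in lborel. z \<notin> {x, y}"
      by (intro AE_not_in finite_imp_null_set_lborel) auto
    thus "AE z in lborel. has_bochner_integral lborel (\<lambda>w. f a b w z) (G z)"
    proof eventually_elim
      case (elim z)
      have "has_bochner_integral lborel (\<lambda>w. f a b w z)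
        (B * of_real ((norm (x - z))\<^sup>2) powr (- a) * of_real ((norm (z - y))\<^sup>2) powr (- b))"
        unfolding f_def B_def using elim Re_pos by (intro has_bochner_integral_Beta) auto
      also have "B * of_real ((norm (x - z))\<^sup>2) powr (- a) * of_real ((norm (z - y))\<^sup>2) powr (- b) = G z"
        using elim by (simp add: G_def eq_commute[of z x] of_real_powr_eq_exp ln_realpow mult_ac del: of_real_power)
      finally show ?case .
    qed
    show "G \<in> borel_measurable lborel"
      unfolding G_def by measurable
  qed (use a b ab in auto)
  hence "has_bochner_integral lborel (\<lambda>z. (1 / B) * G z)
     ((1 / B) * (K a b * (Gamma (h - b) * Gamma (h - a) / Gamma (h - b + (h - a)))))"
    by (rule has_bochner_integral_mult_right)
  moreover have nz: "Gamma a \<noteq> 0" "Gamma b \<noteq> 0" "Gamma (a + b) \<noteq> 0"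
    using Re_pos by (intro Gamma_nonzero_if_Re_pos; simp)+
  hence "B \<noteq> 0" by (simp add: B_def)
  moreover have "(1 / B) * (K a b * (Gamma (h - b) * Gamma (h - a) / Gamma (h - b + (h - a))))
      = of_real pi powr h * (Gamma (h - a) * Gamma (h - b) * Gamma (a + b - h))
       / (Gamma (h - a + (h - b)) * Gamma a * Gamma b) * of_real R powr (2 * (h - a - b))"
    using nz by (simp add: B_def K_def add.commute[of "h - b"] mult_ac)
  ultimately show ?thesis
    by (simp add: G_def R_def)
qed

section \<open>The constants and the final formula\<close>

text \<open>The powers of 2 cancel because their exponents are additive in the parameters, and one
  factor \<open>pi powr (n / 2)\<close> survives.\<close>

lemma riesz_k_eq_riesz_gamma:
  assumes "Re (\<alpha> + \<beta>) < n / 2"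
  shows "riesz_k \<alpha> \<beta> n = riesz_gamma \<alpha> n * riesz_gamma \<beta> n / riesz_gamma (\<alpha> + \<beta>) n"
proof -
  have "Gamma (of_nat n / 2 - (\<alpha> + \<beta>)) \<noteq> 0"
    using assms by (intro Gamma_nonzero_if_Re_pos) simp
  moreover have "(2 :: complex) powr (2 * (\<alpha> + \<beta>)) = 2 powr (2 * \<alpha>) * 2 powr (2 * \<beta>)"
    by (simp add: powr_add distrib_left)
  ultimately show ?thesis
    by (simp add: riesz_k_def riesz_gamma_def diff_diff_eq field_simps)
qed

theorem theorem4p2:
  fixes \<alpha> \<beta> :: complex and x y :: "real ^ 'n"
  assumes "Re \<alpha> \<in> {0<..<real CARD('n) / 2}"
    and "Re \<beta> \<in> {0<..<real CARD('n) / 2}"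
    and "Re (\<alpha> + \<beta>) \<in> {0<..<real CARD('n) / 2}"
    and "x \<noteq> y"
  shows "integrable lborel (riesz_integrand \<alpha> \<beta> x y)
    \<and> (LINT x'|lborel. riesz_integrand \<alpha> \<beta> x y x')
        = riesz_k \<alpha> \<beta> CARD('n)
          * of_real (norm (x - y)) powr (2 * \<alpha> + 2 * \<beta> - of_nat CARD('n))
    \<and> riesz_k \<alpha> \<beta> CARD('n)
        = riesz_gamma \<alpha> CARD('n) * riesz_gamma \<beta> CARD('n) / riesz_gamma (\<alpha> + \<beta>) CARD('n)"
proof -
  define h :: complex where "h = of_nat CARD('n) / 2"
  have "has_bochner_integral lborel
    (\<lambda>z. of_real (norm (x - z)) powr (- 2 * (h - \<alpha>)) * of_real (norm (z - y)) powr (- 2 * (h - \<beta>)))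
    (of_real pi powr h * (Gamma (h - (h - \<alpha>)) * Gamma (h - (h - \<beta>)) * Gamma (h - \<alpha> + (h - \<beta>) - h))
       / (Gamma (h - (h - \<alpha>) + (h - (h - \<beta>))) * Gamma (h - \<alpha>) * Gamma (h - \<beta>))
       * of_real (norm (x - y)) powr (2 * (h - (h - \<alpha>) - (h - \<beta>))))"
    \<comment> \<open>Positivity of \<open>Re \<alpha>\<close> and \<open>Re \<beta>\<close> becomes
      \<open>Re a < Re h\<close> and \<open>Re b < Re h\<close>, and the upper bound on
      \<open>Re (\<alpha> + \<beta>)\<close> becomes \<open>Re (a + b) > Re h\<close>.\<close>
    using has_bochner_integral_riesz[of "h - \<alpha>" "h - \<beta>" x y] assms by (simp add: h_def)
  also have "(\<lambda>z. of_real (norm (x - z)) powr (- 2 * (h - \<alpha>)) * of_real (norm (z - y)) powr (- 2 * (h - \<beta>)))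
      = riesz_integrand \<alpha> \<beta> x y"
    by (simp add: riesz_integrand_def h_def fun_eq_iff algebra_simps)
  also have "of_real pi powr h * (Gamma (h - (h - \<alpha>)) * Gamma (h - (h - \<beta>)) * Gamma (h - \<alpha> + (h - \<beta>) - h))
       / (Gamma (h - (h - \<alpha>) + (h - (h - \<beta>))) * Gamma (h - \<alpha>) * Gamma (h - \<beta>))
       * of_real (norm (x - y)) powr (2 * (h - (h - \<alpha>) - (h - \<beta>)))
      = riesz_k \<alpha> \<beta> CARD('n) * of_real (norm (x - y)) powr (2 * \<alpha> + 2 * \<beta> - of_nat CARD('n))"
  proof -
    have e1: "2 * (h - (h - \<alpha>) - (h - \<beta>)) = 2 * \<alpha> + 2 * \<beta> - of_nat CARD('n)"
      by (simp add: h_def algebra_simps)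
    have e2: "h - \<alpha> + (h - \<beta>) - h = h - \<alpha> - \<beta>" by simp
    show ?thesis
      unfolding e1 e2 riesz_k_def by (simp flip: h_def)
  qed
  finally show ?thesis
    using assms by (simp add: has_bochner_integral_iff riesz_k_eq_riesz_gamma)
qed

end
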